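(* Let $n\ge2$ and let $\mathcal{C}$ be the set of all trees on $n$ vertices satisfying some given property (i.e. any set of trees on $n$ vertices). Then the trees in $\mathcal{C}$ attaining the maximum (respectively minimum) of Kemeny's constant $\kappa$ over $\mathcal{C}$ are exactly the trees in $\mathcal{C}$ attaining the maximum (respectively minimum) of the Wiener index $W$ over $\mathcal{C}$.
   Context: Graphs are finite, simple and undirected. Let $G$ be a connected graph with vertex set $\{1,\dots,n\}$, $n\ge2$. Let $m_G$ be its number of edges, $\tau_G$ its number of spanning trees, and $\mathbf{d}_G$ the column vector whose $i$-th entry is the degree of vertex $i$. A 2-tree spanning forest of $G$ is a spanning subgraph that is a forest with exactly two connected components (trees). Let $f^G_{i,j}$ be the number of 2-tree spanning forests of $G$ in which one of the two trees contains $i$ and the other contains $j$ (so $f^G_{i,i}=0$), and let $F_G=[f^G_{i,j}]_{i,j=1}^n$. Kemeny's constant of (the random walk on) $G$ is $$\kappa(G)=\frac{\mathbf{d}_G^TF_G\mathbf{d}_G}{4m_G\tau_G}.$$ The Wiener index of $G$ is $W(G)=\frac12\mathbf{1}^TD\mathbf{1}$, where $D=[\mathrm{dist}_G(i,j)]_{i,j=1}^n$ is the distance matrix and $\mathbf{1}$ is the all-ones vector; that is, $W(G)$ is the sum of the distances over all unordered pairs of vertices. *)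

theory Defs
  imports "HOL-Analysis.Analysis"
begin

(* A graph on the finite vertex type 'n is given by its edge set, a set of two-element
   subsets of the vertices; the vertex set is always UNIV :: 'n set. Hence the spanning
   subgraphs of G correspond exactly to the subsets of its edge set. *)
type_synonym 'n graph = "'n set set"

definition simple_graph :: "'n graph \<Rightarrow> bool" where
  "simple_graph G \<longleftrightarrow> (\<forall>e\<in>G. card e = 2)"

definition adj :: "'n graph \<Rightarrow> 'n rel" where
  "adj G = {(u, v). {u, v} \<in> G}"

definition graph_connected :: "'n graph \<Rightarrow> bool" where
  "graph_connected G \<longleftrightarrow> (\<forall>u v. (u, v) \<in> (adj G)\<^sup>*)"

definition graph_components :: "'n graph \<Rightarrow> 'n set set" where
  "graph_components G = UNIV // (adj G)\<^sup>*"

(* The vertices of a cycle are listed without repeating the first one at the end. *)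
definition graph_cycle :: "'n graph \<Rightarrow> 'n list \<Rightarrow> bool" where
  "graph_cycle G xs \<longleftrightarrow>
     length xs \<ge> 3 \<and> distinct xs \<and> successively (\<lambda>u v. (u, v) \<in> adj G) xs \<and>
     (last xs, hd xs) \<in> adj G"

definition is_forest :: "'n graph \<Rightarrow> bool" where
  "is_forest G \<longleftrightarrow> simple_graph G \<and> (\<nexists>xs. graph_cycle G xs)"

definition is_tree :: "'n graph \<Rightarrow> bool" where
  "is_tree G \<longleftrightarrow> is_forest G \<and> graph_connected G"

definition num_edges :: "'n graph \<Rightarrow> nat" where
  "num_edges G = card G"

definition num_spanning_trees :: "'n graph \<Rightarrow> nat" where
  "num_spanning_trees G = card {H. H \<subseteq> G \<and> is_tree H}"

definition graph_degree :: "'n graph \<Rightarrow> 'n \<Rightarrow> nat" where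
  "graph_degree G i = card {e \<in> G. i \<in> e}"

definition degree_vec :: "'n::finite graph \<Rightarrow> real ^ 'n" where
  "degree_vec G = (\<chi> i. real (graph_degree G i))"

definition two_tree_spanning_forest :: "'n graph \<Rightarrow> 'n graph \<Rightarrow> bool" where
  "two_tree_spanning_forest G H \<longleftrightarrow>
     H \<subseteq> G \<and> is_forest H \<and> card (graph_components H) = 2"

definition num_separating_forests :: "'n graph \<Rightarrow> 'n \<Rightarrow> 'n \<Rightarrow> nat" where
  "num_separating_forests G i j =
     card {H. two_tree_spanning_forest G H \<and>
              (\<exists>A\<in>graph_components H. \<exists>B\<in>graph_components H. A \<noteq> B \<and> i \<in> A \<and> j \<in> B)}"

definition forest_matrix :: "'n::finite graph \<Rightarrow> real ^ 'n ^ 'n" where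
  "forest_matrix G = (\<chi> i j. real (num_separating_forests G i j))"

definition kemeny :: "'n::finite graph \<Rightarrow> real" where
  "kemeny G =
     (degree_vec G \<bullet> (forest_matrix G *v degree_vec G)) /
     (4 * real (num_edges G) * real (num_spanning_trees G))"

(* Least number of edges of a walk from i to j; meaningful only if j is reachable from i. *)
definition graph_dist :: "'n graph \<Rightarrow> 'n \<Rightarrow> 'n \<Rightarrow> nat" where
  "graph_dist G i j = (LEAST k. (i, j) \<in> adj G ^^ k)"

definition distance_matrix :: "'n::finite graph \<Rightarrow> real ^ 'n ^ 'n" where
  "distance_matrix G = (\<chi> i j. real (graph_dist G i j))"

(* In the type of real vectors, 1 is the all-ones vector. *)
definition wiener :: "'n::finite graph \<Rightarrow> real" where
  "wiener G = 1 / 2 * ((1 :: real ^ 'n) \<bullet> (distance_matrix G *v 1))"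

end

theory Submission
  imports Defs
begin

text \<open>
  In a tree \<open>T\<close> with \<open>n\<close> vertices the spanning forests with two components are the graphs
  \<open>T - e\<close>, and \<open>T - e\<close> separates \<open>i\<close> from \<open>j\<close> iff \<open>e\<close> lies on the path between them, so the
  forest matrix is the distance matrix. Sending every vertex \<open>v \<noteq> r\<close> to the first edge on
  its path to \<open>r\<close> is a bijection onto the edges, and the end points of that edge have
  distances \<open>dist v r\<close> and \<open>dist v r - 1\<close> from \<open>r\<close>. Hence
  \<open>\<Sum>v. deg v * dist v r = 2 * (\<Sum>v. dist v r) - (n - 1)\<close>. Using this for both
  factors in Kemeny's constant exhibits it as an increasing affine function of the Wiener
  index whose coefficients depend on \<open>n\<close> only.
\<close>

section \<open>Reachability and deletion of an edge\<close>

lemma equiv_adj_rtrancl: "equiv UNIV ((adj G)\<^sup>*)"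
proof -
  have "sym (adj G)"
    by (auto simp: adj_def sym_def insert_commute)
  then show ?thesis
    by (auto simp: equiv_def refl_on_def sym_rtrancl trans_rtrancl)
qed

lemma adj_rtrancl_sym: "(x, y) \<in> (adj G)\<^sup>* \<Longrightarrow> (y, x) \<in> (adj G)\<^sup>*"
  using equiv_adj_rtrancl[of G] by (meson equiv_def symE)

lemma adj_rtrancl_mono: "G \<subseteq> H \<Longrightarrow> (x, y) \<in> (adj G)\<^sup>* \<Longrightarrow> (x, y) \<in> (adj H)\<^sup>*"
  using rtrancl_mono[of "adj G" "adj H"] by (auto simp: adj_def)

text \<open>\<open>graph_cycle\<close> asks for distinct vertices, so walks have to be shortened to
  paths before a cycle can be built from them.\<close>

lemma rtrancl_distinct_path:
  assumes "(a, b) \<in> R\<^sup>*"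
  shows "\<exists>xs. xs \<noteq> [] \<and> hd xs = a \<and> last xs = b \<and> distinct xs \<and>
    successively (\<lambda>u v. (u, v) \<in> R) xs"
  using assms
proof (induction rule: rtrancl_induct)
  case base
  show ?case by (rule exI[of _ "[a]"]) simp
next
  case (step y z)
  then obtain xs where xs: "xs \<noteq> []" "hd xs = a" "last xs = y" "distinct xs"
    "successively (\<lambda>u v. (u, v) \<in> R) xs"
    by blast
  show ?case
  proof (cases "z \<in> set xs")
    case True
    then obtain ys zs where "xs = ys @ z # zs"
      by (meson split_list)
    \<comment> \<open>The new vertex was visited before, so the path is cut back to that
      visit.\<close>
    with xs show ?thesis
      by (intro exI[of _ "ys @ [z]"]) (auto simp: successively_append_iff hd_append)
  next
    case False
    with xs step(2) show ?thesis
      by (intro exI[of _ "xs @ [z]"]) (auto simp: successively_append_iff)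
  qed
qed

text \<open>A path from \<open>a\<close> to \<open>b\<close> that avoids the edge
  \<open>{a, b}\<close> would close up with this edge to a cycle.\<close>

lemma forest_edge_separates:
  assumes "is_forest G" "{a, b} \<in> G"
  shows "(a, b) \<notin> (adj (G - {{a, b}}))\<^sup>*"
proof
  assume "(a, b) \<in> (adj (G - {{a, b}}))\<^sup>*"
  then obtain xs where xs: "xs \<noteq> []" "hd xs = a" "last xs = b" "distinct xs"
    "successively (\<lambda>u v. (u, v) \<in> adj (G - {{a, b}})) xs"
    using rtrancl_distinct_path by metis
  have "a \<noteq> b"
    using assms by (auto simp: is_forest_def simple_graph_def)
  \<comment> \<open>One vertex would force \<open>a = b\<close>, and a path with two vertices would
    use the deleted edge.\<close>
  with xs have "length xs \<ge> 3"
    by (cases xs; cases "tl xs"; cases "tl (tl xs)") (auto simp: adj_def)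
  moreover have "successively (\<lambda>u v. (u, v) \<in> adj G) xs"
    by (rule successively_mono[OF xs(5)]) (auto simp: adj_def)
  moreover have "(last xs, hd xs) \<in> adj G"
    using xs assms(2) by (simp add: adj_def insert_commute)
  ultimately have "graph_cycle G xs"
    using xs(4) by (simp add: graph_cycle_def)
  with assms(1) show False
    by (auto simp: is_forest_def)
qed

text \<open>Follow a walk from \<open>x\<close> to \<open>a\<close> until it first meets
  \<open>{a, b}\<close>; at that moment it stands at \<open>a\<close> or \<open>b\<close>.\<close>

lemma connected_delete_edge:
  assumes "graph_connected G"
  shows "(x, a) \<in> (adj (G - {{a, b}}))\<^sup>* \<or> (x, b) \<in> (adj (G - {{a, b}}))\<^sup>*"
proof -
  have "(x, a) \<in> (adj G)\<^sup>*"
    using assms by (auto simp: graph_connected_def)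
  then show ?thesis
  proof (induction rule: converse_rtrancl_induct)
    case base
    show ?case by simp
  next
    case (step y z)
    then show ?case
      by (cases "{y, z} = {a, b}")
        (auto simp: doubleton_eq_iff adj_def intro: converse_rtrancl_into_rtrancl)
  qed
qed

section \<open>Trees and the edges separating two vertices\<close>

lemma tree_edgeE:
  assumes "is_tree T" "e \<in> T"
  obtains a b where "e = {a, b}" "a \<noteq> b"
  using assms by (auto simp: is_tree_def is_forest_def simple_graph_def card_2_iff)

lemma tree_edge_separates:
  "is_tree T \<Longrightarrow> {a, b} \<in> T \<Longrightarrow> (a, b) \<notin> (adj (T - {{a, b}}))\<^sup>*"
  by (simp add: is_tree_def forest_edge_separates)

lemma forest_subgraph:
  assumes "is_forest G" "H \<subseteq> G"
  shows "is_forest H"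
proof -
  have "adj H \<subseteq> adj G"
    using assms(2) by (auto simp: adj_def)
  then have "graph_cycle G xs" if "graph_cycle H xs" for xs
    using that successively_mono[of "\<lambda>u v. (u, v) \<in> adj H" xs "\<lambda>u v. (u, v) \<in> adj G"]
    unfolding graph_cycle_def by blast
  with assms show ?thesis
    unfolding is_forest_def simple_graph_def by blast
qed

text \<open>In a tree these are the edges of the path from \<open>i\<close> to \<open>j\<close>.
  This form speaks of reachability only, so no path has to be chosen.\<close>

definition separating_edges :: "'n graph \<Rightarrow> 'n \<Rightarrow> 'n \<Rightarrow> 'n set set" where
  "separating_edges G i j = {e \<in> G. (i, j) \<notin> (adj (G - {e}))\<^sup>*}"

lemma separating_edges_refl [simp]: "separating_edges G i i = {}"
  by (simp add: separating_edges_def)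

lemma separating_edges_step:
  assumes "{x, y} \<in> G" "e \<noteq> {x, y}"
  shows "e \<in> separating_edges G x z \<longleftrightarrow> e \<in> separating_edges G y z"
proof -
  have "(x, y) \<in> adj (G - {e})" "(y, x) \<in> adj (G - {e})"
    using assms by (auto simp: adj_def insert_commute)
  then have "(x, z) \<in> (adj (G - {e}))\<^sup>* \<longleftrightarrow> (y, z) \<in> (adj (G - {e}))\<^sup>*"
    using converse_rtrancl_into_rtrancl[of x y _ z] converse_rtrancl_into_rtrancl[of y x _ z]
    by blast
  then show ?thesis
    by (simp add: separating_edges_def)
qed

text \<open>Deleting \<open>{x, y}\<close> leaves one part with \<open>x\<close> and one with
  \<open>y\<close>, and \<open>z\<close> lies in exactly one of them.\<close>

lemma separating_edges_ends:
  assumes "is_tree T" "{x, y} \<in> T"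
  shows "{x, y} \<in> separating_edges T x z \<longleftrightarrow> {x, y} \<notin> separating_edges T y z"
proof -
  let ?R = "(adj (T - {{x, y}}))\<^sup>*"
  have xy: "(x, y) \<notin> ?R"
    using assms by (rule tree_edge_separates)
  have "(z, x) \<in> ?R \<or> (z, y) \<in> ?R"
    using connected_delete_edge[of T z x y] assms(1) by (simp add: is_tree_def)
  then have "(x, z) \<in> ?R \<or> (y, z) \<in> ?R"
    by (blast intro: adj_rtrancl_sym)
  moreover have "\<not> ((x, z) \<in> ?R \<and> (y, z) \<in> ?R)"
    using xy adj_rtrancl_sym[of y z "T - {{x, y}}"] rtrancl_trans[of x z _ y] by blast
  ultimately show ?thesis
    using assms(2) by (auto simp: separating_edges_def)
qed

section \<open>Two-tree spanning forests of a tree\<close>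

lemma graph_components_delete_edge:
  assumes "is_tree T" "e \<in> T"
  shows "card (graph_components (T - {e})) = 2"
proof -
  obtain a b where e: "e = {a, b}"
    using tree_edgeE[OF assms] by blast
  let ?R = "(adj (T - {e}))\<^sup>*"
  have sep: "(a, b) \<notin> ?R"
    using assms e tree_edge_separates[of T a b] by simp
  have "?R `` {x} = ?R `` {a} \<or> ?R `` {x} = ?R `` {b}" for x
    using connected_delete_edge[of T x a b] assms(1) e
      eq_equiv_class_iff[OF equiv_adj_rtrancl[of "T - {e}"], of x]
    by (simp add: is_tree_def)
  then have "range (\<lambda>x. ?R `` {x}) \<subseteq> {?R `` {a}, ?R `` {b}}"
    by (simp only: image_subset_iff) simp
  then have "range (\<lambda>x. ?R `` {x}) = {?R `` {a}, ?R `` {b}}"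
    by (rule subset_antisym) simp
  then have "graph_components (T - {e}) = {?R `` {a}, ?R `` {b}}"
    by (simp add: graph_components_def quotient_def UNION_singleton_eq_range)
  moreover have "?R `` {a} \<noteq> ?R `` {b}"
    using sep eq_equiv_class_iff[OF equiv_adj_rtrancl[of "T - {e}"]] by simp
  ultimately show ?thesis by simp
qed

text \<open>Sending an \<open>R\<close>-class to the \<open>S\<close>-class around it is surjective,
  hence injective when the finite numbers of classes agree. This compares two graphs through their
  numbers of components, without counting edges.\<close>

lemma refining_equiv_eq:
  assumes "equiv UNIV R" "equiv UNIV S" "R \<subseteq> S"
    and "card (UNIV // R) = card (UNIV // S)" "finite (UNIV // R)"
  shows "R = S"
proof -
  let ?f = "\<lambda>X. S `` X"
  have f: "S `` (R `` {x}) = S `` {x}" for x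
  proof -
    have "trans S" "(x, x) \<in> R"
      using assms(1,2) by (auto simp: equiv_def refl_on_def)
    with assms(3) show ?thesis
      by (blast dest: transD)
  qed
  have "?f ` (UNIV // R) = UNIV // S"
    by (auto simp: quotient_def f image_UN)
  with assms(4,5) have inj: "inj_on ?f (UNIV // R)"
    by (simp add: eq_card_imp_inj_on)
  have "(x, y) \<in> R" if "(x, y) \<in> S" for x y
  proof -
    have "?f (R `` {x}) = ?f (R `` {y})"
      using that assms(2) by (simp add: f equiv_class_eq)
    then have "R `` {x} = R `` {y}"
      using inj_on_eq_iff[OF inj, of "R `` {x}" "R `` {y}"] by (simp add: quotientI)
    then show ?thesis
      using eq_equiv_class_iff[OF assms(1), of x y] by simp
  qed
  with assms(3) show ?thesis by auto
qed

lemma two_tree_spanning_forest_tree: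
  fixes T :: "'n::finite graph"
  assumes T: "is_tree T"
  shows "two_tree_spanning_forest T H \<longleftrightarrow> (\<exists>e\<in>T. H = T - {e})"
proof
  assume H: "two_tree_spanning_forest T H"
  have "graph_components T = {UNIV}"
    using T by (auto simp: is_tree_def graph_connected_def graph_components_def quotient_def)
  with H have "H \<noteq> T" "H \<subseteq> T"
    by (auto simp: two_tree_spanning_forest_def)
  then obtain e where e: "e \<in> T" "e \<notin> H"
    by blast
  \<comment> \<open>\<open>H\<close> lies inside \<open>T - {e}\<close> and both have two
    components.\<close>
  have R: "(adj H)\<^sup>* = (adj (T - {e}))\<^sup>*"
  proof (rule refining_equiv_eq)
    show "(adj H)\<^sup>* \<subseteq> (adj (T - {e}))\<^sup>*"
      using adj_rtrancl_mono[of H "T - {e}"] e \<open>H \<subseteq> T\<close> by auto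
    show "card (UNIV // (adj H)\<^sup>*) = card (UNIV // (adj (T - {e}))\<^sup>*)"
      using H graph_components_delete_edge[OF T e(1)]
      by (simp add: two_tree_spanning_forest_def graph_components_def)
  qed (simp_all add: equiv_adj_rtrancl)
  \<comment> \<open>If \<open>H\<close> missed a second edge \<open>f\<close>, the ends of
    \<open>f\<close> would be joined in \<open>T - {e}\<close>, hence in \<open>H\<close>, hence in
    \<open>T - {f}\<close>.\<close>
  have "f \<in> H" if f: "f \<in> T" "f \<noteq> e" for f
  proof (rule ccontr)
    assume "f \<notin> H"
    obtain c d where cd: "f = {c, d}"
      using tree_edgeE[OF T f(1)] by blast
    then have "(c, d) \<in> (adj (T - {e}))\<^sup>*"
      using f by (auto simp: adj_def)
    then have "(c, d) \<in> (adj (T - {f}))\<^sup>*"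
      using R adj_rtrancl_mono[of H "T - {f}"] \<open>f \<notin> H\<close> \<open>H \<subseteq> T\<close> by auto
    then show False
      using tree_edge_separates[OF T] f cd by blast
  qed
  with e \<open>H \<subseteq> T\<close> show "\<exists>e\<in>T. H = T - {e}"
    by (intro bexI[of _ e]) auto
next
  assume "\<exists>e\<in>T. H = T - {e}"
  with T show "two_tree_spanning_forest T H"
    by (auto simp: two_tree_spanning_forest_def graph_components_delete_edge is_tree_def
        intro: forest_subgraph)
qed

text \<open>The forests counted are the graphs \<open>T - {e}\<close>, and each determines its
  \<open>e\<close>. Lying in different components is the same as not being reachable from each
  other.\<close>

lemma num_separating_forests_tree:
  fixes T :: "'n::finite graph"
  assumes T: "is_tree T"
  shows "num_separating_forests T i j = card (separating_edges T i j)"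
proof -
  have comp: "(\<exists>A\<in>graph_components H. \<exists>B\<in>graph_components H. A \<noteq> B \<and> i \<in> A \<and> j \<in> B)
      \<longleftrightarrow> (i, j) \<notin> (adj H)\<^sup>*" (is "?L \<longleftrightarrow> ?R") for H :: "'n graph"
  proof
    assume ?L
    then obtain A B where AB: "A \<in> UNIV // (adj H)\<^sup>*" "B \<in> UNIV // (adj H)\<^sup>*" "A \<noteq> B" "i \<in> A" "j \<in> B"
      by (auto simp: graph_components_def)
    then show ?R
      using quotient_eqI[OF equiv_adj_rtrancl] by metis
  next
    assume ?R
    then have "(adj H)\<^sup>* `` {i} \<noteq> (adj H)\<^sup>* `` {j}"
      using equiv_adj_rtrancl[of H] by (simp add: eq_equiv_class_iff)
    then show ?L
      by (intro bexI[of _ "(adj H)\<^sup>* `` {i}"] bexI[of _ "(adj H)\<^sup>* `` {j}"])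
        (auto simp: graph_components_def intro: quotientI)
  qed
  have "{H. two_tree_spanning_forest T H \<and> (i, j) \<notin> (adj H)\<^sup>*}
      = (\<lambda>e. T - {e}) ` separating_edges T i j"
    by (auto simp: two_tree_spanning_forest_tree[OF T] separating_edges_def)
  moreover have "inj_on (\<lambda>e. T - {e}) (separating_edges T i j)"
    by (auto simp: inj_on_def separating_edges_def)
  ultimately show ?thesis
    by (simp add: num_separating_forests_def comp card_image)
qed

text \<open>A spanning tree missing an edge \<open>e\<close> of \<open>T\<close> would still connect
  the ends of \<open>e\<close> inside \<open>T - {e}\<close>.\<close>

lemma num_spanning_trees_tree:
  assumes T: "is_tree T"
  shows "num_spanning_trees T = 1"
proof -
  have "H = T" if H: "H \<subseteq> T" "is_tree H" for H
  proof (rule ccontr)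
    assume "H \<noteq> T"
    with H obtain e where e: "e \<in> T" "e \<notin> H" by blast
    then obtain a b where ab: "e = {a, b}"
      using tree_edgeE[OF T] by blast
    have "(a, b) \<in> (adj H)\<^sup>*"
      using H(2) by (simp add: is_tree_def graph_connected_def)
    then have "(a, b) \<in> (adj (T - {e}))\<^sup>*"
      using adj_rtrancl_mono[of H "T - {e}"] e H(1) by auto
    with ab e tree_edge_separates[OF T] show False by blast
  qed
  with T have "{H. H \<subseteq> T \<and> is_tree H} = {T}" by auto
  then show ?thesis by (simp add: num_spanning_trees_def)
qed

section \<open>Distances, shortest walks and parents of vertices\<close>

lemma graph_dist_le: "(i, j) \<in> adj G ^^ k \<Longrightarrow> graph_dist G i j \<le> k"
  unfolding graph_dist_def by (rule Least_le)

lemma graph_dist_walk: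
  assumes "graph_connected G"
  shows "(i, j) \<in> adj G ^^ graph_dist G i j"
proof -
  have "\<exists>k. (i, j) \<in> adj G ^^ k"
    using assms by (auto simp: graph_connected_def rtrancl_power)
  then show ?thesis
    unfolding graph_dist_def by (rule LeastI_ex)
qed

lemma graph_dist_self [simp]: "graph_dist G i i = 0"
  using graph_dist_le[of i i 0 G] by simp

text \<open>Every vertex on the walk reaches \<open>j\<close> in at most \<open>k\<close> steps,
  which \<open>i\<close> cannot do. So the walk misses \<open>i\<close> and with it every edge at
  \<open>i\<close>.\<close>

lemma short_walk_avoids:
  assumes "(x, j) \<in> adj G ^^ k" "k < graph_dist G i j" "i \<in> e"
  shows "(x, j) \<in> (adj (G - {e}))\<^sup>*"
  using assms(1,2)
proof (induction k arbitrary: x)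
  case 0
  then show ?case by simp
next
  case (Suc k)
  obtain y where y: "(x, y) \<in> adj G" "(y, j) \<in> adj G ^^ k"
    using Suc.prems(1) by (meson relpow_Suc_D2)
  have "x \<noteq> i" "y \<noteq> i"
    using Suc.prems graph_dist_le y(2) by fastforce+
  then have "(x, y) \<in> adj (G - {e})"
    using y(1) assms(3) by (auto simp: adj_def)
  moreover have "(y, j) \<in> (adj (G - {e}))\<^sup>*"
    using Suc y by auto
  ultimately show ?case by (rule converse_rtrancl_into_rtrancl)
qed

text \<open>Here \<open>x\<close> is the second vertex of a shortest walk from \<open>v\<close> to
  \<open>r\<close>. The rest of that walk is too short to return to \<open>v\<close>, so it survives
  the deletion of any edge at \<open>v\<close>.\<close>

lemma graph_dist_first_edge:
  assumes "graph_connected G" "v \<noteq> r"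
  obtains x where "{v, x} \<in> G" "graph_dist G v r = Suc (graph_dist G x r)"
    "\<And>e. v \<in> e \<Longrightarrow> e \<notin> separating_edges G x r"
proof -
  obtain k where k: "graph_dist G v r = Suc k"
    using graph_dist_walk[OF assms(1), of v r] assms(2)
    by (cases "graph_dist G v r") auto
  then obtain x where x: "(v, x) \<in> adj G" "(x, r) \<in> adj G ^^ k"
    using graph_dist_walk[OF assms(1), of v r] by (metis relpow_Suc_D2)
  have "graph_dist G v r \<le> Suc (graph_dist G x r)"
    using x(1) graph_dist_walk[OF assms(1), of x r] by (meson graph_dist_le relpow_Suc_I2)
  with k x graph_dist_le have "graph_dist G v r = Suc (graph_dist G x r)"
    by fastforce
  moreover have "e \<notin> separating_edges G x r" if "v \<in> e" for e
    using short_walk_avoids[OF x(2), of v e] k that by (simp add: separating_edges_def)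
  moreover have "{v, x} \<in> G"
    using x(1) by (simp add: adj_def)
  ultimately show thesis using that by blast
qed

text \<open>With \<open>T\<close> rooted at \<open>r\<close>, \<open>x\<close> is the parent of
  \<open>v\<close>. The last property is what later shows that every edge joins some vertex to its
  parent.\<close>

lemma tree_parent:
  assumes "is_tree T" "v \<noteq> r"
  obtains x where "{v, x} \<in> T" "graph_dist T v r = Suc (graph_dist T x r)"
    "separating_edges T v r = insert {v, x} (separating_edges T x r)"
    "{v, x} \<notin> separating_edges T x r"
    "\<And>e. e \<in> separating_edges T v r \<Longrightarrow> v \<in> e \<Longrightarrow> e = {v, x}"
proof -
  obtain x where x: "{v, x} \<in> T" "graph_dist T v r = Suc (graph_dist T x r)"
    "\<And>e. v \<in> e \<Longrightarrow> e \<notin> separating_edges T x r"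
    using graph_dist_first_edge[of T v r] assms by (auto simp: is_tree_def)
  \<comment> \<open>The edge contains \<open>v\<close>, so it does not separate \<open>x\<close>
    from \<open>r\<close>; hence it separates its other end.\<close>
  have "{v, x} \<in> separating_edges T v r"
    using separating_edges_ends[OF assms(1) x(1)] x(3) by blast
  then have "e \<in> separating_edges T v r \<longleftrightarrow> e \<in> insert {v, x} (separating_edges T x r)" for e
    using separating_edges_step[OF x(1), of e r] by (cases "e = {v, x}") simp_all
  then have "separating_edges T v r = insert {v, x} (separating_edges T x r)"
    by (rule set_eqI)
  with x show thesis
    by (intro that[of x]) auto
qed

text \<open>Passing from \<open>i\<close> to its parent towards \<open>j\<close> removes one
  separating edge and lowers the distance by one.\<close>

lemma card_separating_edges:
  fixes T :: "'n::finite graph"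
  assumes "is_tree T"
  shows "card (separating_edges T i j) = graph_dist T i j"
proof (induction "graph_dist T i j" arbitrary: i rule: less_induct)
  case less
  show ?case
  proof (cases "i = j")
    case False
    then obtain x where "graph_dist T i j = Suc (graph_dist T x j)"
      "separating_edges T i j = insert {i, x} (separating_edges T x j)"
      "{i, x} \<notin> separating_edges T x j"
      using tree_parent[OF assms] by metis
    with less[of x] show ?thesis by simp
  qed simp
qed

text \<open>Two vertices with the same parent edge would be parents of each other, against the
  distances. An edge separates exactly one of its ends from \<open>r\<close>, and it is the parent
  edge of that end.\<close>

lemma tree_parent_edges:
  fixes T :: "'n::finite graph"
  assumes T: "is_tree T"
  obtains p where "bij_betw (\<lambda>v. {v, p v}) (UNIV - {r}) T"
    "\<And>v. v \<noteq> r \<Longrightarrow> graph_dist T v r = Suc (graph_dist T (p v) r)"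
proof -
  \<comment> \<open>The guard stands under the quantifier so that choice yields a total
    \<open>p\<close>; its value at \<open>r\<close> is arbitrary.\<close>
  have "\<exists>x. v \<noteq> r \<longrightarrow> {v, x} \<in> T \<and> graph_dist T v r = Suc (graph_dist T x r) \<and>
      (\<forall>e. e \<in> separating_edges T v r \<longrightarrow> v \<in> e \<longrightarrow> e = {v, x})" for v
    using tree_parent[OF T, of v r] by metis
  then obtain p where p: "v \<noteq> r \<Longrightarrow> {v, p v} \<in> T"
    "v \<noteq> r \<Longrightarrow> graph_dist T v r = Suc (graph_dist T (p v) r)"
    "v \<noteq> r \<Longrightarrow> e \<in> separating_edges T v r \<Longrightarrow> v \<in> e \<Longrightarrow> e = {v, p v}" for v e
    by metis
  have inj: "inj_on (\<lambda>v. {v, p v}) (UNIV - {r})"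
  proof (rule inj_onI, rule ccontr)
    fix v w assume vw: "v \<in> UNIV - {r}" "w \<in> UNIV - {r}" "{v, p v} = {w, p w}" "v \<noteq> w"
    then have "p v = w" "p w = v" by (auto simp: doubleton_eq_iff)
    with p(2)[of v] p(2)[of w] vw show False by simp
  qed
  have "e \<in> (\<lambda>v. {v, p v}) ` (UNIV - {r})" if e: "e \<in> T" for e
  proof -
    obtain a b where ab: "e = {a, b}" using tree_edgeE[OF T e] by blast
    then have "e \<in> separating_edges T a r \<or> e \<in> separating_edges T b r"
      using separating_edges_ends[OF T, of a b r] e by blast
    then obtain v where v: "v \<in> e" "e \<in> separating_edges T v r" using ab by blast
    then have "v \<noteq> r" by auto
    with v p(3)[of v e] show ?thesis by blast
  qed
  with p(1) have "(\<lambda>v. {v, p v}) ` (UNIV - {r}) = T" by auto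
  with inj p(2) show thesis
    using that[of p] by (auto simp: bij_betw_def)
qed

lemma card_tree_edges:
  fixes T :: "'n::finite graph"
  assumes "is_tree T"
  shows "card T = CARD('n) - 1"
proof -
  \<comment> \<open>Any root will do; \<open>undefined\<close> stands for an arbitrary
    vertex.\<close>
  obtain p where "bij_betw (\<lambda>v. {v, p v}) (UNIV - {undefined :: 'n}) T"
    using tree_parent_edges[OF assms] by metis
  then have "card (UNIV - {undefined :: 'n}) = card T"
    by (rule bij_betw_same_card)
  then show ?thesis by (simp add: card_Diff_singleton)
qed

section \<open>Degree sums and Kemeny's constant\<close>

lemma sum_degree_weighted:
  fixes G :: "'n::finite graph" and h :: "'n \<Rightarrow> real"
  shows "(\<Sum>v\<in>UNIV. real (graph_degree G v) * h v) = (\<Sum>e\<in>G. \<Sum>v\<in>e. h v)"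
proof -
  have "(\<Sum>v\<in>UNIV. real (graph_degree G v) * h v) = (\<Sum>v\<in>UNIV. \<Sum>e | e \<in> G \<and> v \<in> e. h v)"
    by (simp add: graph_degree_def)
  \<comment> \<open>Double counting of the incident pairs of a vertex and an edge.\<close>
  also have "\<dots> = (\<Sum>e\<in>G. \<Sum>v | v \<in> UNIV \<and> v \<in> e. h v)"
    by (rule sum.swap_restrict) auto
  finally show ?thesis by simp
qed

lemma sum_degree_tree:
  fixes T :: "'n::finite graph"
  assumes T: "is_tree T"
  shows "(\<Sum>v\<in>UNIV. real (graph_degree T v)) = 2 * (real CARD('n) - 1)"
proof -
  have "(\<Sum>v\<in>UNIV. real (graph_degree T v)) = (\<Sum>e\<in>T. real (card e))"
    using sum_degree_weighted[of T "\<lambda>_. 1"] by simp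
  also have "\<dots> = (\<Sum>e\<in>T. 2)"
    using T by (intro sum.cong) (auto simp: is_tree_def is_forest_def simple_graph_def)
  finally show ?thesis
    by (simp add: card_tree_edges[OF T] of_nat_diff Suc_leI)
qed

lemma sum_degree_dist:
  fixes T :: "'n::finite graph"
  assumes T: "is_tree T"
  shows "(\<Sum>v\<in>UNIV. real (graph_degree T v) * real (graph_dist T v r)) =
    2 * (\<Sum>v\<in>UNIV. real (graph_dist T v r)) - (real CARD('n) - 1)"
proof -
  let ?d = "\<lambda>v. real (graph_dist T v r)"
  obtain p where p: "bij_betw (\<lambda>v. {v, p v}) (UNIV - {r}) T"
    "\<And>v. v \<noteq> r \<Longrightarrow> graph_dist T v r = Suc (graph_dist T (p v) r)"
    using tree_parent_edges[OF T] by metis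
  have "(\<Sum>v\<in>UNIV. real (graph_degree T v) * ?d v) = (\<Sum>e\<in>T. \<Sum>v\<in>e. ?d v)"
    by (rule sum_degree_weighted)
  also have "\<dots> = (\<Sum>v\<in>UNIV - {r}. \<Sum>w\<in>{v, p v}. ?d w)"
    by (rule sum.reindex_bij_betw[OF p(1), symmetric])
  also have "\<dots> = (\<Sum>v\<in>UNIV - {r}. 2 * ?d v - 1)"
  proof (rule sum.cong)
    fix v assume "v \<in> UNIV - {r}"
    with p(2)[of v] have d: "graph_dist T v r = Suc (graph_dist T (p v) r)" by simp
    \<comment> \<open>Without this the sum over the set \<open>{v, p v}\<close> could collapse to
      one term.\<close>
    then have "v \<noteq> p v" by auto
    with d show "(\<Sum>w\<in>{v, p v}. ?d w) = 2 * ?d v - 1" by simp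
  qed simp
  also have "\<dots> = 2 * (\<Sum>v\<in>UNIV - {r}. ?d v) - (real CARD('n) - 1)"
    by (simp add: sum_subtractf sum_distrib_left card_Diff_singleton of_nat_diff Suc_leI)
  \<comment> \<open>The root has distance 0 from itself.\<close>
  also have "(\<Sum>v\<in>UNIV - {r}. ?d v) = (\<Sum>v\<in>UNIV. ?d v)"
    by (simp add: sum.remove[of UNIV r])
  finally show ?thesis .
qed

lemma adj_relpow_sym: "(i, j) \<in> adj G ^^ k \<Longrightarrow> (j, i) \<in> adj G ^^ k"
proof (induction k arbitrary: i)
  case (Suc k)
  then obtain y where "(i, y) \<in> adj G" "(y, j) \<in> adj G ^^ k"
    by (meson relpow_Suc_D2)
  then have "(y, i) \<in> adj G" "(j, y) \<in> adj G ^^ k"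
    using Suc.IH by (auto simp: adj_def insert_commute)
  then show ?case by (rule relpow_Suc_I[rotated])
qed simp

lemma graph_dist_sym: "graph_dist G i j = graph_dist G j i"
proof -
  have "(i, j) \<in> adj G ^^ k \<longleftrightarrow> (j, i) \<in> adj G ^^ k" for k
    using adj_relpow_sym by metis
  then show ?thesis by (simp add: graph_dist_def)
qed

text \<open>The denominator is \<open>4 * m * tau\<close> with \<open>m = n - 1\<close> and
  \<open>tau = 1\<close>. For \<open>n = 1\<close> both sides are 0 by the convention for division
  by zero.\<close>

lemma kemeny_tree:
  fixes T :: "'n::finite graph"
  assumes T: "is_tree T"
  defines "n \<equiv> real CARD('n)"
  shows "kemeny T = (8 * wiener T - 2 * n * (n - 1) - 2 * (n - 1)\<^sup>2) / (4 * (n - 1))"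
proof -
  let ?deg = "\<lambda>v. real (graph_degree T v)" and ?D = "\<lambda>i j. real (graph_dist T i j)"
  have W: "2 * wiener T = (\<Sum>i\<in>UNIV. \<Sum>j\<in>UNIV. ?D i j)"
    by (simp add: wiener_def distance_matrix_def inner_vec_def matrix_vector_mult_def)
  have row: "(\<Sum>j\<in>UNIV. ?D i j * ?deg j) = 2 * (\<Sum>j\<in>UNIV. ?D i j) - (n - 1)" for i
    using sum_degree_dist[OF T, of i] by (simp add: n_def graph_dist_sym[of T i] mult.commute)
  have "degree_vec T \<bullet> (forest_matrix T *v degree_vec T) =
      (\<Sum>i\<in>UNIV. ?deg i * (\<Sum>j\<in>UNIV. ?D i j * ?deg j))"
    by (simp add: degree_vec_def forest_matrix_def inner_vec_def matrix_vector_mult_def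
        num_separating_forests_tree[OF T] card_separating_edges[OF T])
  \<comment> \<open>\<open>sum_degree_dist\<close> removes the degrees in \<open>j\<close> here and
    those in \<open>i\<close> after the swap. The two doublings act on a sum over ordered pairs,
    which is \<open>2 * wiener T\<close>; hence the factor 8.\<close>
  also have "\<dots> = 2 * (\<Sum>i\<in>UNIV. \<Sum>j\<in>UNIV. ?deg i * ?D i j) - (n - 1) * (\<Sum>i\<in>UNIV. ?deg i)"
    unfolding row by (simp add: right_diff_distrib sum_subtractf sum_distrib_left mult_ac)
  also have "(\<Sum>i\<in>UNIV. \<Sum>j\<in>UNIV. ?deg i * ?D i j) = (\<Sum>j\<in>UNIV. \<Sum>i\<in>UNIV. ?deg i * ?D i j)"
    by (rule sum.swap)
  also have "\<dots> = 2 * (\<Sum>j\<in>UNIV. \<Sum>i\<in>UNIV. ?D i j) - n * (n - 1)"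
    by (simp add: sum_degree_dist[OF T] n_def sum_subtractf sum_distrib_left)
  also have "(\<Sum>j\<in>UNIV. \<Sum>i\<in>UNIV. ?D i j) = 2 * wiener T"
    unfolding W by (rule sum.swap)
  also have "(\<Sum>i\<in>UNIV. ?deg i) = 2 * (n - 1)"
    using sum_degree_tree[OF T] by (simp add: n_def)
  finally have "degree_vec T \<bullet> (forest_matrix T *v degree_vec T) =
      8 * wiener T - 2 * n * (n - 1) - 2 * (n - 1)\<^sup>2"
    by (simp add: power2_eq_square algebra_simps)
  moreover have "real (num_edges T) = n - 1"
    by (simp add: num_edges_def card_tree_edges[OF T] n_def of_nat_diff Suc_leI)
  ultimately show ?thesis
    by (simp add: kemeny_def num_spanning_trees_tree[OF T])
qed

theorem theorem2p1:
  fixes \<C> :: "'n::finite graph set"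
  assumes "CARD('n) \<ge> 2"
    and "\<And>T. T \<in> \<C> \<Longrightarrow> is_tree T"
  shows "{T. is_arg_max kemeny (\<lambda>T. T \<in> \<C>) T} = {T. is_arg_max wiener (\<lambda>T. T \<in> \<C>) T}
    \<and> {T. is_arg_min kemeny (\<lambda>T. T \<in> \<C>) T} = {T. is_arg_min wiener (\<lambda>T. T \<in> \<C>) T}"
proof -
  \<comment> \<open>Two or more vertices make the denominator \<open>4 * (n - 1)\<close> positive.
    Strict comparisons suffice, since \<open>is_arg_max\<close> and \<open>is_arg_min\<close> are
    defined by them.\<close>
  have "kemeny S < kemeny T \<longleftrightarrow> wiener S < wiener T" if "S \<in> \<C>" "T \<in> \<C>" for S T
    using assms(1) kemeny_tree[OF assms(2)[OF that(1)]] kemeny_tree[OF assms(2)[OF that(2)]]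
    by (simp add: divide_less_cancel)
  then show ?thesis
    by (auto simp: is_arg_max_def is_arg_min_def)
qed

end
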